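(* With $\epsilon_p$, $\epsilon_u$, $\xi$, $\Delta$ and all distributions as defined in the context, put $$C_1=\frac1K\sum_{k=1}^K\sqrt{\mathrm{JS}(F^{\mathcal O}_k\|F^{\mathcal B}_k)} .$$ Then $$C_1\le \epsilon_p+\frac1K\sum_{k=1}^K\frac12\,(e^{2\xi}-1)\,\mathrm{TV}(P_k^{\mathcal O}\|P_k^{\mathcal S}).$$ Furthermore, suppose that $\epsilon_u$ is taken at the convergence step (i.e. $\mathcal W_a^{\mathcal O}\subset\mathcal W_a^*$), that $\mathrm{TV}(P_a^{\mathcal O}\|P_a^{\mathcal S})>0$, and that $\Delta>0$. Then $$C_1\le\epsilon_p+C_2\,\epsilon_u,\qquad C_2=\frac{\gamma}{4\Delta}(e^{2\xi}-1),\qquad \gamma=\frac{\sum_{k=1}^K\mathrm{TV}(P_k^{\mathcal O}\|P_k^{\mathcal S})}{\mathrm{TV}(P_a^{\mathcal O}\|P_a^{\mathcal S})}.$$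
   Context: There are $K$ clients. For $k\in[K]=\{1,\dots,K\}$, $D_k$ is client $k$'s private data, a random variable with support $\mathcal D_k$ (reference measure $\mu$); $P_k^{\mathcal O}$ and $P_k^{\mathcal S}$ are the distributions (on $\mathbb R^n$) of the unprotected and protected model information of client $k$; $\mathcal W_k$ is the union of their supports. $P_a^{\mathcal O}$, $P_a^{\mathcal S}$ are the distributions of the unprotected and protected aggregated model information, with supports $\mathcal W_a^{\mathcal O}$, $\mathcal W_a^{\mathcal S}$, and $\mathcal W_a=\mathcal W_a^{\mathcal O}\cup\mathcal W_a^{\mathcal S}$; $p^{\mathcal S}_{W_a}$ is the density of $P_a^{\mathcal S}$. Adversary's beliefs: $f_{D_k}$ is a prior density on $\mathcal D_k$ and, for $w\in\mathcal W_k$, $f_{D_k|W_k}(\cdot|w)$ is the posterior density given $w$. $F^{\mathcal A}_k$, $F^{\mathcal O}_k$, $F^{\mathcal B}_k$ are the distributions on $\mathcal D_k$ with densities $f^{\mathcal A}_{D_k}(d)=\int_{\mathcal W_k}f_{D_k|W_k}(d|w)\,dP_k^{\mathcal S}(w)$, $f^{\mathcal O}_{D_k}(d)=\int_{\mathcal W_k}f_{D_k|W_k}(d|w)\,dP_k^{\mathcal O}(w)$, $f^{\mathcal B}_{D_k}(d)=f_{D_k}(d)$. $\mathrm{KL}(P\|Q)=\int p\log(p/q)$; $\mathrm{JS}(P\|Q)=\frac12[\mathrm{KL}(P\|M)+\mathrm{KL}(Q\|M)]$ with $M=(P+Q)/2$; $\mathrm{TV}(P\|Q)=\sup_A|P(A)-Q(A)|$.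 Privacy leakage: $\epsilon_{p,k}=\sqrt{\mathrm{JS}(F_k^{\mathcal A}\|F_k^{\mathcal B})}$ and $\epsilon_p=\frac1K\sum_{k=1}^K\epsilon_{p,k}$. $\xi=\max_{k\in[K]}\xi_k$, $\xi_k=\max_{w\in\mathcal W_k,\,d\in\mathcal D_k}\left|\log\frac{f_{D_k|W_k}(d|w)}{f_{D_k}(d)}\right|$ (assumed well defined and finite). Utility: $U(w,d)$ is a real-valued utility of model $w$ on data point $d$; $U_k(w)=\mathbb E_{D_k}\frac1{|D_k|}\sum_{d\in D_k}U(w,d)$ and $U_k(P)=\mathbb E_{w\sim P}U_k(w)$. Utility loss: $\epsilon_u=\frac1K\sum_{k=1}^K[U_k(P_a^{\mathcal O})-U_k(P_a^{\mathcal S})]$. Optimal parameters: $\mathcal W_a^*=\arg\max_{w\in\mathcal W_a}\frac1K\sum_{k=1}^KU_k(w)$. For $c\ge0$, near-optimal parameters: $\mathcal W_c=\{w\in\mathcal W_a^{\mathcal S}:|\frac1K\sum_kU_k(w^* )-\frac1K\sum_kU_k(w)|\le c\ \ \forall w^*\in\mathcal W_a^*\}$. $\Delta$ is the maximum constant satisfying $\int_{\mathcal W_a^{\mathcal S}}p^{\mathcal S}_{W_a}(w)\mathbf 1\{w\in\mathcal W_\Delta\}\,dw\le\frac12\mathrm{TV}(P_a^{\mathcal O}\|P_a^{\mathcal S})$. "At the convergence step" means that the unprotected aggregated model attains the maximal utility, i.e. $\mathcal W_a^{\mathcal O}\subset\mathcal W_a^*$.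
   Formalization: The second inequality (with C_2 and ε_u) is stated only for K ≥ 3 clients, because with these definitions it is false for K = 1 and K = 2; the first inequality is for all K ≥ 1. *)

theory Defs
  imports "HOL-Probability.Probability"
begin

section \<open>Divergences between distributions\<close>

definition TV :: "'a measure \<Rightarrow> 'a measure \<Rightarrow> real" where
  "TV P Q = (SUP A\<in>sets P. \<bar>measure P A - measure Q A\<bar>)"

text \<open>The library's \<^const>\<open>KL_divergence\<close> takes the reference distribution first, hence the
  swapped arguments; base \<^term>\<open>exp 1\<close> gives the natural logarithm.\<close>

definition KL :: "'a measure \<Rightarrow> 'a measure \<Rightarrow> real" where
  "KL P Q = KL_divergence (exp 1) Q P"

definition midpoint_measure :: "'a measure \<Rightarrow> 'a measure \<Rightarrow> 'a measure" where
  "midpoint_measure P Q =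
     measure_of (space P) (sets P) (\<lambda>A. (emeasure P A + emeasure Q A) / 2)"

text \<open>For probability measures \<open>P\<close>, \<open>Q\<close> on a common measurable space, both are absolutely continuous
  with respect to their midpoint, with densities at most 2. So both \<^const>\<open>KL\<close> terms below are finite,
  and the convention that a non-integrable integral is 0 plays no role.\<close>

definition JS :: "'a measure \<Rightarrow> 'a measure \<Rightarrow> real" where
  "JS P Q = (KL P (midpoint_measure P Q) + KL Q (midpoint_measure P Q)) / 2"

definition measure_supp :: "'a::topological_space measure \<Rightarrow> 'a set" where
  "measure_supp P = {x. \<forall>V. open V \<longrightarrow> x \<in> V \<longrightarrow> emeasure P V > 0}"


section \<open>Federated learning systems\<close>

text \<open>A client's data set is a finite multiset of data points of type \<^typ>\<open>'z\<close>, and a model is a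
  vector in \<^typ>\<open>real ^ 'n\<close>. Clients are indexed by \<open>1, \<dots>, num_clients\<close>. The suffixes \<open>O\<close> and \<open>S\<close>
  stand for unprotected and protected; \<open>pa_S\<close> is the Lebesgue density of the protected aggregated
  model. \<open>posterior S k w d\<close> is the adversary's belief density at \<open>d\<close> given \<open>w\<close>.\<close>

record ('o, 'z, 'n) fl_system =
  num_clients :: nat
  prob_sp :: "'o measure"
  ref_measure :: "'z multiset measure"
  client_data :: "nat \<Rightarrow> 'o \<Rightarrow> 'z multiset"
  data_density :: "nat \<Rightarrow> 'z multiset \<Rightarrow> ennreal"
  P_O :: "nat \<Rightarrow> (real ^ 'n) measure"
  P_S :: "nat \<Rightarrow> (real ^ 'n) measure"
  Pa_O :: "(real ^ 'n) measure"
  pa_S :: "real ^ 'n \<Rightarrow> real"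
  prior :: "nat \<Rightarrow> 'z multiset \<Rightarrow> real"
  posterior :: "nat \<Rightarrow> real ^ 'n \<Rightarrow> 'z multiset \<Rightarrow> real"
  utility :: "real ^ 'n \<Rightarrow> 'z \<Rightarrow> real"

definition Pa_S :: "('o, 'z, 'n::finite) fl_system \<Rightarrow> (real ^ 'n) measure" where
  "Pa_S S = density lborel (\<lambda>w. ennreal (pa_S S w))"

definition data_supp :: "('o, 'z, 'n::finite) fl_system \<Rightarrow> nat \<Rightarrow> 'z multiset set" where
  "data_supp S k = {d \<in> space (ref_measure S). data_density S k d \<noteq> 0}"

definition data_measure :: "('o, 'z, 'n::finite) fl_system \<Rightarrow> nat \<Rightarrow> 'z multiset measure" where
  "data_measure S k = restrict_space (ref_measure S) (data_supp S k)"

definition W :: "('o, 'z, 'n::finite) fl_system \<Rightarrow> nat \<Rightarrow> (real ^ 'n) set" where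
  "W S k = measure_supp (P_O S k) \<union> measure_supp (P_S S k)"

definition Wa_O :: "('o, 'z, 'n::finite) fl_system \<Rightarrow> (real ^ 'n) set" where
  "Wa_O S = measure_supp (Pa_O S)"

definition Wa_S :: "('o, 'z, 'n::finite) fl_system \<Rightarrow> (real ^ 'n) set" where
  "Wa_S S = measure_supp (Pa_S S)"

definition Wa :: "('o, 'z, 'n::finite) fl_system \<Rightarrow> (real ^ 'n) set" where
  "Wa S = Wa_O S \<union> Wa_S S"


subsection \<open>Privacy leakage\<close>

definition F_A :: "('o, 'z, 'n::finite) fl_system \<Rightarrow> nat \<Rightarrow> 'z multiset measure" where
  "F_A S k = density (data_measure S k)
     (\<lambda>d. ennreal (LINT w:W S k|P_S S k. posterior S k w d))"

definition F_O :: "('o, 'z, 'n::finite) fl_system \<Rightarrow> nat \<Rightarrow> 'z multiset measure" where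
  "F_O S k = density (data_measure S k)
     (\<lambda>d. ennreal (LINT w:W S k|P_O S k. posterior S k w d))"

definition F_B :: "('o, 'z, 'n::finite) fl_system \<Rightarrow> nat \<Rightarrow> 'z multiset measure" where
  "F_B S k = density (data_measure S k) (\<lambda>d. ennreal (prior S k d))"

definition eps_p_client :: "('o, 'z, 'n::finite) fl_system \<Rightarrow> nat \<Rightarrow> real" where
  "eps_p_client S k = sqrt (JS (F_A S k) (F_B S k))"

definition eps_p :: "('o, 'z, 'n::finite) fl_system \<Rightarrow> real" where
  "eps_p S = 1 / real (num_clients S) * (\<Sum>k=1..num_clients S. eps_p_client S k)"

definition xi_client :: "('o, 'z, 'n::finite) fl_system \<Rightarrow> nat \<Rightarrow> real" where
  "xi_client S k =
     (SUP (w, d)\<in>W S k \<times> data_supp S k. \<bar>ln (posterior S k w d / prior S k d)\<bar>)"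

definition xi :: "('o, 'z, 'n::finite) fl_system \<Rightarrow> real" where
  "xi S = Max (xi_client S ` {1..num_clients S})"

definition C1 :: "('o, 'z, 'n::finite) fl_system \<Rightarrow> real" where
  "C1 S = 1 / real (num_clients S) * (\<Sum>k=1..num_clients S. sqrt (JS (F_O S k) (F_B S k)))"


subsection \<open>Utility\<close>

definition data_utility ::
  "('o, 'z, 'n::finite) fl_system \<Rightarrow> real ^ 'n \<Rightarrow> 'z multiset \<Rightarrow> real" where
  "data_utility S w D = 1 / real (size D) * (\<Sum>d\<in>#D. utility S w d)"

definition client_utility ::
  "('o, 'z, 'n::finite) fl_system \<Rightarrow> nat \<Rightarrow> real ^ 'n \<Rightarrow> real" where
  "client_utility S k w = (LINT \<omega>|prob_sp S. data_utility S w (client_data S k \<omega>))"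

definition client_utility_dist ::
  "('o, 'z, 'n::finite) fl_system \<Rightarrow> nat \<Rightarrow> (real ^ 'n) measure \<Rightarrow> real" where
  "client_utility_dist S k P = (LINT w|P. client_utility S k w)"

definition eps_u :: "('o, 'z, 'n::finite) fl_system \<Rightarrow> real" where
  "eps_u S = 1 / real (num_clients S) *
     (\<Sum>k=1..num_clients S.
        client_utility_dist S k (Pa_O S) - client_utility_dist S k (Pa_S S))"

definition avg_utility :: "('o, 'z, 'n::finite) fl_system \<Rightarrow> real ^ 'n \<Rightarrow> real" where
  "avg_utility S w = 1 / real (num_clients S) * (\<Sum>k=1..num_clients S. client_utility S k w)"

definition W_opt :: "('o, 'z, 'n::finite) fl_system \<Rightarrow> (real ^ 'n) set" where
  "W_opt S = {w. is_arg_max (avg_utility S) (\<lambda>w. w \<in> Wa S) w}"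

definition W_near :: "('o, 'z, 'n::finite) fl_system \<Rightarrow> real \<Rightarrow> (real ^ 'n) set" where
  "W_near S c =
     {w \<in> Wa_S S. \<forall>w'\<in>W_opt S. \<bar>avg_utility S w' - avg_utility S w\<bar> \<le> c}"

definition is_Delta :: "('o, 'z, 'n::finite) fl_system \<Rightarrow> real \<Rightarrow> bool" where
  "is_Delta S \<Delta> \<longleftrightarrow>
     is_arg_max (\<lambda>c. c)
       (\<lambda>c. 0 \<le> c \<and>
          (LINT w:Wa_S S|lborel. pa_S S w * indicat_real (W_near S c) w)
            \<le> 1 / 2 * TV (Pa_O S) (Pa_S S)) \<Delta>"

definition gamma :: "('o, 'z, 'n::finite) fl_system \<Rightarrow> real" where
  "gamma S = (\<Sum>k=1..num_clients S. TV (P_O S k) (P_S S k)) / TV (Pa_O S) (Pa_S S)"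

definition C2 :: "('o, 'z, 'n::finite) fl_system \<Rightarrow> real \<Rightarrow> real" where
  "C2 S \<Delta> = gamma S / (4 * \<Delta>) * (exp (2 * xi S) - 1)"


subsection \<open>Standing assumptions\<close>

text \<open>Besides the typing of the components, the assumptions say that the quantities above are well
  defined: beliefs are positive on \<open>W S k \<times> data_supp S k\<close> (so that the log-ratios make sense),
  the log-ratios are bounded (so that \<open>xi_client\<close> is a finite supremum), data sets are non-empty,
  and all expected utilities exist.\<close>

locale fl_setting =
  fixes S :: "('o, 'z, 'n::finite) fl_system"
  assumes clients: "1 \<le> num_clients S"
    and prob_sp: "prob_space (prob_sp S)"
    and data_distributed: "\<And>k. k \<in> {1..num_clients S} \<Longrightarrow>
      distributed (prob_sp S) (ref_measure S) (client_data S k) (data_density S k)"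
    and data_nonempty: "\<And>k. k \<in> {1..num_clients S} \<Longrightarrow> {#} \<notin> data_supp S k"
    and P_O: "\<And>k. k \<in> {1..num_clients S} \<Longrightarrow> prob_space (P_O S k)"
      "\<And>k. k \<in> {1..num_clients S} \<Longrightarrow> sets (P_O S k) = sets borel"
    and P_S: "\<And>k. k \<in> {1..num_clients S} \<Longrightarrow> prob_space (P_S S k)"
      "\<And>k. k \<in> {1..num_clients S} \<Longrightarrow> sets (P_S S k) = sets borel"
    and Pa_O: "prob_space (Pa_O S)" "sets (Pa_O S) = sets borel"
    and pa_S: "pa_S S \<in> borel_measurable borel" "\<And>w. 0 \<le> pa_S S w"
    and Pa_S: "prob_space (Pa_S S)"
    and prior_measurable: "\<And>k. k \<in> {1..num_clients S} \<Longrightarrow>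
      prior S k \<in> borel_measurable (data_measure S k)"
    and prior_pos: "\<And>k d. k \<in> {1..num_clients S} \<Longrightarrow> d \<in> data_supp S k \<Longrightarrow> 0 < prior S k d"
    and prior_density: "\<And>k. k \<in> {1..num_clients S} \<Longrightarrow>
      prob_space (density (data_measure S k) (\<lambda>d. ennreal (prior S k d)))"
    and posterior_measurable: "\<And>k. k \<in> {1..num_clients S} \<Longrightarrow>
      (\<lambda>(w, d). posterior S k w d)
        \<in> borel_measurable (restrict_space borel (W S k) \<Otimes>\<^sub>M data_measure S k)"
    and posterior_pos: "\<And>k w d. k \<in> {1..num_clients S} \<Longrightarrow> w \<in> W S k \<Longrightarrow> d \<in> data_supp S k \<Longrightarrow>
      0 < posterior S k w d"
    and posterior_density: "\<And>k w. k \<in> {1..num_clients S} \<Longrightarrow> w \<in> W S k \<Longrightarrow>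
      prob_space (density (data_measure S k) (\<lambda>d. ennreal (posterior S k w d)))"
    and log_ratio_bounded: "\<And>k. k \<in> {1..num_clients S} \<Longrightarrow>
      bdd_above ((\<lambda>(w, d). \<bar>ln (posterior S k w d / prior S k d)\<bar>) ` (W S k \<times> data_supp S k))"
    and data_utility_integrable: "\<And>k w. k \<in> {1..num_clients S} \<Longrightarrow> w \<in> Wa S \<Longrightarrow>
      integrable (prob_sp S) (\<lambda>\<omega>. data_utility S w (client_data S k \<omega>))"
    and client_utility_integrable:
      "\<And>k. k \<in> {1..num_clients S} \<Longrightarrow> integrable (Pa_O S) (client_utility S k)"
      "\<And>k. k \<in> {1..num_clients S} \<Longrightarrow> integrable (Pa_S S) (client_utility S k)"

end

theory Submission
  imports Defs "HOL-Real_Asymp.Real_Asymp"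
begin

text \<open>The square root of the Jensen-Shannon divergence is a Hilbertian distance: the pointwise
  divergence \<open>L(x, y) = x ln (2x / (x + y)) + y ln (2y / (x + y))\<close> satisfies
  \<open>2 L(x, y) = \<integral> ((exp(-xs) - exp(-ys)) / s)\<^sup>2 ds\<close> over \<open>s > 0\<close>. This gives the triangle inequality, so
  only the distance between \<open>F_O\<close> and \<open>F_A\<close> has to be bounded. Their densities are mixtures, over
  \<open>P_O\<close> and \<open>P_S\<close>, of posteriors with values between \<open>m = exp(-\<xi>) \<cdot> prior\<close> and \<open>exp(2\<xi>) m\<close>; so they
  differ by at most \<open>(exp(2\<xi>) - 1) TV m\<close>, and \<open>L(x, y) \<le> (x - y)\<^sup>2 / (4 min(x, y))\<close> turns this into
  \<open>sqrt JS \<le> (exp(2\<xi>) - 1) TV / sqrt 8\<close>.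

  At the convergence step the utility loss is the expected gap to the optimum under the protected
  model. This gap exceeds \<open>\<Delta>\<close> with probability at least \<open>1 - TV/2 \<ge> TV/2\<close>, hence the loss is at least
  \<open>\<Delta> TV/2\<close>, and since \<open>1 / sqrt 8 \<le> 3/8\<close> the second bound follows for at least three clients.\<close>

section \<open>The pointwise Jensen-Shannon divergence\<close>

text \<open>With \<open>m = (x + y) / 2\<close> this is \<open>x ln (x / m) + y ln (y / m)\<close>:
  the function \<open>L\<close> of the overview, and the integrand of twice \<open>JS\<close> for
  densities \<open>x\<close> and \<open>y\<close>.\<close>

definition js_kernel :: "real \<Rightarrow> real \<Rightarrow> real" where
  "js_kernel x y = x * ln (2 * x / (x + y)) + y * ln (2 * y / (x + y))"

lemma js_kernel_commute: "js_kernel x y = js_kernel y x"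
  by (simp add: js_kernel_def add.commute)

text \<open>With \<open>F z = z ln z\<close> the right side is
  \<open>F (2 x) + F (2 y) - 2 F (x + y)\<close>, the form in which integrating
  \<open>1 / (t + u)\<close> over a square produces it.\<close>

lemma js_kernel_eq:
  assumes "0 < x" "0 < y"
  shows "2 * js_kernel x y =
    2 * x * ln (2 * x) + 2 * y * ln (2 * y) - 2 * ((x + y) * ln (x + y))"
proof -
  have "ln (2 * x / (x + y)) = ln (2 * x) - ln (x + y)" "ln (2 * y / (x + y)) = ln (2 * y) - ln (x + y)"
    using assms by (simp_all add: ln_div)
  then show ?thesis
    unfolding js_kernel_def by (simp only:) (simp add: algebra_simps)
qed

text \<open>Apply \<open>ln v \<le> v - 1\<close> at \<open>v = (x + y) / (2 x)\<close>. The bound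
  changes sign when \<open>x\<close> and \<open>y\<close> are swapped, so adding the two instances
  gives nonnegativity of \<open>js_kernel\<close>.\<close>

lemma mult_ln_ge:
  fixes x y :: real
  assumes "0 < x" "0 < y"
  shows "(x - y) / 2 \<le> x * ln (2 * x / (x + y))"
proof -
  have "ln ((x + y) / (2 * x)) \<le> (x + y) / (2 * x) - 1"
    using assms by (intro ln_le_minus_one) auto
  moreover have "ln (2 * x / (x + y)) = - ln ((x + y) / (2 * x))"
    using assms by (simp add: ln_div)
  ultimately have "1 - (x + y) / (2 * x) \<le> ln (2 * x / (x + y))" by simp
  then have "x * (1 - (x + y) / (2 * x)) \<le> x * ln (2 * x / (x + y))"
    using assms by (intro mult_left_mono) auto
  moreover have "x * (1 - (x + y) / (2 * x)) = (x - y) / 2"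
    using assms by (simp add: field_simps)
  ultimately show ?thesis by simp
qed

lemma mult_ln_le:
  fixes x y :: real
  assumes "0 < x" "0 < y"
  shows "x * ln (2 * x / (x + y)) \<le> x"
proof -
  have "ln (2 * x / (x + y)) \<le> 2 * x / (x + y) - 1"
    using assms by (intro ln_le_minus_one) auto
  also have "\<dots> \<le> 1" using assms by (simp add: field_simps)
  finally show ?thesis using assms by (simp add: mult_left_le)
qed

lemma js_kernel_nonneg:
  assumes "0 < x" "0 < y"
  shows "0 \<le> js_kernel x y"
  using mult_ln_ge[of x y] mult_ln_ge[of y x] assms
  by (simp add: js_kernel_def add.commute field_simps)

text \<open>Both sides vanish at \<open>x = y\<close>, so it is enough to compare derivatives in
  \<open>x\<close>: that of \<open>js_kernel z y\<close> is \<open>ln (2 z / (z + y))\<close>, at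
  most \<open>(z - y) / (z + y)\<close> and hence at most \<open>(z - y) / (2 y)\<close>.\<close>

lemma js_kernel_le_sq_ordered:
  assumes "0 < y" "y \<le> x"
  shows "js_kernel x y \<le> (x - y)\<^sup>2 / (4 * y)"
proof -
  define h where "h z = (z - y)\<^sup>2 / (4 * y) - js_kernel z y" for z
  have "h y \<le> h x"
  proof (rule DERIV_nonneg_imp_nondecreasing[OF assms(2)])
    fix z assume z: "y \<le> z" "z \<le> x"
    have "(h has_real_derivative ((z - y) / (2 * y) - ln (2 * z / (z + y)))) (at z)"
    proof -
      have "(h has_real_derivative (2 * (z - y) / (4 * y)
           - (ln (2 * z / (z + y)) + z * (1 / (2 * z / (z + y)) * ((2 * (z + y) - 2 * z) / (z + y)\<^sup>2))
              + y * (1 / (2 * y / (z + y)) * (- 2 * y / (z + y)\<^sup>2))))) (at z)"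
        unfolding h_def js_kernel_def using z assms
        by (auto intro!: derivative_eq_intros simp: power2_eq_square field_simps)
      \<comment> \<open>The terms from differentiating inside the two logarithms are
        \<open>y / (z + y)\<close> and its negative.\<close>
      moreover have "z * (1 / (2 * z / (z + y)) * ((2 * (z + y) - 2 * z) / (z + y)\<^sup>2))
              + y * (1 / (2 * y / (z + y)) * (- 2 * y / (z + y)\<^sup>2)) = 0"
      proof -
        have "z \<noteq> 0" "y \<noteq> 0" "z + y \<noteq> 0" using z assms by auto
        then show ?thesis by (simp add: divide_simps power2_eq_square)
      qed
      moreover have "2 * (z - y) / (4 * y) = (z - y) / (2 * y)" using assms by (simp add: field_simps)
      ultimately show ?thesis by (simp only: add.assoc add_0_right)
    qed
    moreover have "ln (2 * z / (z + y)) \<le> (z - y) / (2 * y)"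
    proof -
      have "ln (2 * z / (z + y)) \<le> 2 * z / (z + y) - 1"
        using assms z by (intro ln_le_minus_one) auto
      also have "\<dots> = (z - y) / (z + y)" using assms z by (simp add: field_simps)
      also have "\<dots> \<le> (z - y) / (2 * y)" using assms z by (intro divide_left_mono) auto
      finally show ?thesis .
    qed
    ultimately show "\<exists>d. (h has_real_derivative d) (at z) \<and> 0 \<le> d"
      by (metis diff_ge_0_iff_ge)
  qed
  moreover have "h y = 0" using assms by (simp add: h_def js_kernel_def)
  ultimately show ?thesis by (simp add: h_def)
qed

lemma js_kernel_le_sq:
  assumes "0 < m" "m \<le> x" "m \<le> y"
  shows "js_kernel x y \<le> (x - y)\<^sup>2 / (4 * m)"
proof -
  have *: "js_kernel b a \<le> (b - a)\<^sup>2 / (4 * m)" if "m \<le> a" "a \<le> b" for a b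
  proof -
    have "js_kernel b a \<le> (b - a)\<^sup>2 / (4 * a)"
      using that assms by (intro js_kernel_le_sq_ordered) auto
    also have "\<dots> \<le> (b - a)\<^sup>2 / (4 * m)"
      using that assms by (intro divide_left_mono) auto
    finally show ?thesis .
  qed
  show ?thesis
  proof (cases "y \<le> x")
    case True
    then show ?thesis using * assms by blast
  next
    case False
    then show ?thesis
      using *[of x y] assms by (simp add: js_kernel_commute[of x y] power2_commute[of x y])
  qed
qed

section \<open>Laplace representation of the pointwise divergence\<close>

lemma nn_integral_exp_Icc:
  fixes x y s :: real
  assumes "x \<le> y" "0 < s"
  shows "(\<integral>\<^sup>+u. ennreal (exp (- (u * s))) * indicator {x..y} u \<partial>lborel)
    = ennreal ((exp (- (x * s)) - exp (- (y * s))) / s)"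
proof -
  have "(\<integral>\<^sup>+u. ennreal (exp (- (u * s))) * indicator {x..y} u \<partial>lborel)
      = ennreal (- exp (- (y * s)) / s - (- exp (- (x * s)) / s))"
    using assms by (intro nn_integral_FTC_Icc) (auto intro!: derivative_eq_intros)
  then show ?thesis by (simp add: diff_divide_distrib)
qed

lemma nn_integral_exp_Ici:
  fixes c :: real
  assumes "0 < c"
  shows "(\<integral>\<^sup>+s. ennreal (exp (- (c * s))) * indicator {0..} s \<partial>lborel) = ennreal (1 / c)"
proof -
  have "((\<lambda>s. - exp (- (c * s)) / c) \<longlongrightarrow> 0) at_top"
    using assms by real_asymp
  then have "(\<integral>\<^sup>+s. ennreal (exp (- (c * s))) * indicator {0..} s \<partial>lborel)
      = ennreal (0 - (- exp (- (c * 0)) / c))"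
    using assms by (intro nn_integral_FTC_atLeast) (auto intro!: derivative_eq_intros)
  then show ?thesis by simp
qed

text \<open>Two applications of the fundamental theorem, with antiderivatives
  \<open>ln (t + u)\<close> in \<open>u\<close> and
  \<open>(t + y) ln (t + y) - (t + x) ln (t + x)\<close> in \<open>t\<close>;
  \<open>js_kernel_eq\<close> recognizes the result.\<close>

lemma nn_integral_Cauchy_kernel:
  fixes x y :: real
  assumes "0 < x" "x \<le> y"
  shows "(\<integral>\<^sup>+t. (\<integral>\<^sup>+u. ennreal (1 / (t + u)) * indicator {x..y} u \<partial>lborel)
      * indicator {x..y} t \<partial>lborel) = ennreal (2 * js_kernel x y)"
proof -
  have "(\<integral>\<^sup>+t. (\<integral>\<^sup>+u. ennreal (1 / (t + u)) * indicator {x..y} u \<partial>lborel)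
      * indicator {x..y} t \<partial>lborel)
    = (\<integral>\<^sup>+t. ennreal (ln (t + y) - ln (t + x)) * indicator {x..y} t \<partial>lborel)"
  proof (intro nn_integral_cong)
    fix t :: real
    have "(\<integral>\<^sup>+u. ennreal (1 / (t + u)) * indicator {x..y} u \<partial>lborel) = ennreal (ln (t + y) - ln (t + x))"
      if "t \<in> {x..y}"
      using that assms by (intro nn_integral_FTC_Icc) (auto intro!: derivative_eq_intros)
    then show "(\<integral>\<^sup>+u. ennreal (1 / (t + u)) * indicator {x..y} u \<partial>lborel) * indicator {x..y} t
       = ennreal (ln (t + y) - ln (t + x)) * indicator {x..y} t"
      by (auto split: split_indicator)
  qed
  also have "\<dots> = ennreal (((y + y) * ln (y + y) - (y + x) * ln (y + x))
      - ((x + y) * ln (x + y) - (x + x) * ln (x + x)))"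
    using assms by (intro nn_integral_FTC_Icc) (auto intro!: derivative_eq_intros)
  also have "\<dots> = ennreal (2 * js_kernel x y)"
  proof -
    have "x + x = 2 * x" "y + y = 2 * y" by auto
    moreover from this have "(y + y) * ln (y + y) - (y + x) * ln (y + x)
        - ((x + y) * ln (x + y) - (x + x) * ln (x + x)) = 2 * js_kernel x y"
      using js_kernel_eq[of x y] assms by (simp add: algebra_simps)
    ultimately show ?thesis by simp
  qed
  finally show ?thesis .
qed

text \<open>The quotient \<open>(exp (- (x * s)) - exp (- (y * s))) / s\<close> is the integral of
  \<open>exp (- (u * s))\<close> over \<open>u\<close> in \<open>{x..y}\<close>. Its square is thus
  a double integral of \<open>exp (- ((t + u) * s))\<close>; integrating over \<open>s\<close> first
  leaves the kernel \<open>1 / (t + u)\<close>.\<close>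

lemma js_kernel_Laplace_ordered:
  fixes x y :: real
  assumes "0 < x" "x \<le> y"
  shows "(\<integral>\<^sup>+s. ennreal (((exp (- (x * s)) - exp (- (y * s))) / s)\<^sup>2) * indicator {0..} s \<partial>lborel)
    = ennreal (2 * js_kernel x y)"
proof -
  let ?I = "indicator {x..y} :: real \<Rightarrow> ennreal" and ?J = "indicator {0..} :: real \<Rightarrow> ennreal"
  define A where "A s = (\<integral>\<^sup>+u. ennreal (exp (- (u * s))) * ?I u \<partial>lborel)" for s
  have A_meas [measurable]: "A \<in> borel_measurable borel"
    unfolding A_def by measurable
  have "(\<integral>\<^sup>+s. ennreal (((exp (- (x * s)) - exp (- (y * s))) / s)\<^sup>2) * ?J s \<partial>lborel)
      = (\<integral>\<^sup>+s. A s * (A s * ?J s) \<partial>lborel)"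
  proof (intro nn_integral_cong_AE)
    \<comment> \<open>At \<open>s = 0\<close> the quotient is 0 by the convention for division by
      zero, whereas \<open>A 0 = y - x\<close>; this single point is discarded.\<close>
    show "AE s in lborel. ennreal (((exp (- (x * s)) - exp (- (y * s))) / s)\<^sup>2) * ?J s = A s * (A s * ?J s)"
      using AE_lborel_singleton[of "0::real"]
    proof eventually_elim
      case (elim s)
      show ?case
      proof (cases "0 < s")
        case True
        then have "0 \<le> (exp (- (x * s)) - exp (- (y * s))) / s" using assms by simp
        then show ?thesis unfolding A_def nn_integral_exp_Icc[OF assms(2) True]
          using True by (simp add: power2_eq_square ennreal_mult del: times_divide_eq_left times_divide_eq_right)
      next
        case False then show ?thesis using elim by (auto split: split_indicator)
      qed
    qed
  qed
  \<comment> \<open>The two factors \<open>A s\<close> are expanded one at a time, so that each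
    application of Tonelli's theorem exchanges only two variables.\<close>
  also have "\<dots> = (\<integral>\<^sup>+s. \<integral>\<^sup>+t. ennreal (exp (- (t * s))) * ?I t * (A s * ?J s) \<partial>lborel \<partial>lborel)"
    by (subst nn_integral_multc) (auto simp: A_def)
  also have "\<dots> = (\<integral>\<^sup>+t. \<integral>\<^sup>+s. ennreal (exp (- (t * s))) * ?I t * (A s * ?J s) \<partial>lborel \<partial>lborel)"
    by (intro lborel_pair.Fubini') measurable
  also have "\<dots> = (\<integral>\<^sup>+t. \<integral>\<^sup>+s. \<integral>\<^sup>+u. ennreal (exp (- (u * s))) * ?I u * (ennreal (exp (- (t * s))) * ?I t * ?J s)
       \<partial>lborel \<partial>lborel \<partial>lborel)"
    by (subst nn_integral_multc) (auto simp: A_def ac_simps)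
  also have "\<dots> = (\<integral>\<^sup>+t. \<integral>\<^sup>+u. \<integral>\<^sup>+s. ennreal (exp (- (u * s))) * ?I u * (ennreal (exp (- (t * s))) * ?I t * ?J s)
       \<partial>lborel \<partial>lborel \<partial>lborel)"
    by (intro nn_integral_cong lborel_pair.Fubini') measurable
  also have "\<dots> = (\<integral>\<^sup>+t. \<integral>\<^sup>+u. (\<integral>\<^sup>+s. ennreal (exp (- ((t + u) * s))) * ?J s \<partial>lborel) * (?I u * ?I t)
       \<partial>lborel \<partial>lborel)"
    by (subst nn_integral_multc[symmetric])
       (auto intro!: nn_integral_cong split: split_indicator
         simp: algebra_simps exp_add exp_diff divide_inverse exp_minus simp flip: ennreal_mult)
  also have "\<dots> = (\<integral>\<^sup>+t. \<integral>\<^sup>+u. ennreal (1 / (t + u)) * (?I u * ?I t) \<partial>lborel \<partial>lborel)"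
    using assms by (intro nn_integral_cong) (auto simp: nn_integral_exp_Ici split: split_indicator)
  also have "\<dots> = (\<integral>\<^sup>+t. (\<integral>\<^sup>+u. ennreal (1 / (t + u)) * ?I u \<partial>lborel) * ?I t \<partial>lborel)"
    by (subst nn_integral_multc[symmetric]) (auto simp: mult.assoc)
  also have "\<dots> = ennreal (2 * js_kernel x y)"
    by (rule nn_integral_Cauchy_kernel[OF assms])
  finally show ?thesis .
qed

lemma js_kernel_Laplace:
  fixes x y :: real
  assumes "0 < x" "0 < y"
  shows "(\<integral>\<^sup>+s. ennreal (((exp (- (x * s)) - exp (- (y * s))) / s)\<^sup>2) * indicator {0..} s \<partial>lborel)
    = ennreal (2 * js_kernel x y)"
proof (cases "x \<le> y")
  case True
  then show ?thesis using assms js_kernel_Laplace_ordered by blast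
next
  case False
  have "((exp (- (x * s)) - exp (- (y * s))) / s)\<^sup>2 = ((exp (- (y * s)) - exp (- (x * s))) / s)\<^sup>2" for s
    by (simp add: power_divide power2_commute)
  then show ?thesis
    using False assms js_kernel_Laplace_ordered[of y x] by (simp add: js_kernel_commute)
qed

section \<open>Triangle inequality for the pointwise divergence, with a free weight\<close>

lemma power2_add_le_weighted:
  fixes a b t :: real
  assumes "0 < t"
  shows "(a + b)\<^sup>2 \<le> (1 + t) * a\<^sup>2 + (1 + 1 / t) * b\<^sup>2"
proof -
  have "0 \<le> (t * a - b)\<^sup>2 / t" using assms by simp
  also have "\<dots> = (1 + t) * a\<^sup>2 + (1 + 1 / t) * b\<^sup>2 - (a + b)\<^sup>2"
    using assms by (simp add: power2_eq_square field_simps)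
  finally show ?thesis by simp
qed

text \<open>For each \<open>s\<close> the difference quotient of the Laplace representation
  telescopes through \<open>z\<close>. The weighted bound for the square of a sum then holds under
  the integral.\<close>

lemma js_kernel_triangle_weighted:
  fixes x y z t :: real
  assumes pos: "0 < x" "0 < y" "0 < z" "0 < t"
  shows "js_kernel x y \<le> (1 + t) * js_kernel x z + (1 + 1 / t) * js_kernel z y"
proof -
  let ?k = "\<lambda>x y s. ((exp (- (x * s)) - exp (- (y * s))) / s)\<^sup>2 :: real"
  have "ennreal (2 * js_kernel x y) = (\<integral>\<^sup>+s. ennreal (?k x y s) * indicator {0..} s \<partial>lborel)"
    using js_kernel_Laplace pos by simp
  also have "\<dots> \<le> (\<integral>\<^sup>+s. ennreal (1 + t) * (ennreal (?k x z s) * indicator {0..} s)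
      + ennreal (1 + 1 / t) * (ennreal (?k z y s) * indicator {0..} s) \<partial>lborel)"
  proof (intro nn_integral_mono)
    fix s :: real
    have "(exp (- (x * s)) - exp (- (y * s))) / s
        = (exp (- (x * s)) - exp (- (z * s))) / s + (exp (- (z * s)) - exp (- (y * s))) / s"
      by (simp add: diff_divide_distrib)
    then have "?k x y s \<le> (1 + t) * ?k x z s + (1 + 1 / t) * ?k z y s"
      using power2_add_le_weighted[OF pos(4)] by simp
    then have "ennreal (?k x y s) \<le> ennreal (1 + t) * ennreal (?k x z s)
        + ennreal (1 + 1 / t) * ennreal (?k z y s)"
      using pos by (simp flip: ennreal_mult ennreal_plus add: ennreal_leI)
    then show "ennreal (?k x y s) * indicator {0..} s \<le> ennreal (1 + t) * (ennreal (?k x z s) * indicator {0..} s)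
      + ennreal (1 + 1 / t) * (ennreal (?k z y s) * indicator {0..} s)"
      by (auto split: split_indicator)
  qed
  also have "\<dots> = ennreal (1 + t) * ennreal (2 * js_kernel x z) + ennreal (1 + 1 / t) * ennreal (2 * js_kernel z y)"
    using js_kernel_Laplace pos by (simp add: nn_integral_add nn_integral_cmult del: ennreal_plus)
  also have "\<dots> = ennreal (2 * ((1 + t) * js_kernel x z + (1 + 1 / t) * js_kernel z y))"
    using pos js_kernel_nonneg[of x z] js_kernel_nonneg[of z y]
    by (simp flip: ennreal_mult ennreal_plus add: algebra_simps)
  finally have "2 * js_kernel x y \<le> 2 * ((1 + t) * js_kernel x z + (1 + 1 / t) * js_kernel z y)"
    using pos js_kernel_nonneg[of x z] js_kernel_nonneg[of z y] by (subst (asm) ennreal_le_iff) auto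
  then show ?thesis by simp
qed

section \<open>The Jensen-Shannon divergence of measures with densities\<close>

text \<open>A measure built by \<open>measure_of\<close> is determined by the values of its set
  function on the measurable sets, and there the half sum of the two measures is the integral of the
  half sum of the densities.\<close>

lemma midpoint_measure_density:
  assumes [measurable]: "p \<in> borel_measurable M" "q \<in> borel_measurable M"
    and nonneg: "\<And>x. x \<in> space M \<Longrightarrow> 0 \<le> p x" "\<And>x. x \<in> space M \<Longrightarrow> 0 \<le> q x"
  shows "midpoint_measure (density M (\<lambda>x. ennreal (p x))) (density M (\<lambda>x. ennreal (q x)))
    = density M (\<lambda>x. ennreal ((p x + q x) / 2))"
proof -
  let ?D = "density M (\<lambda>x. ennreal ((p x + q x) / 2))"
  have eq: "(emeasure (density M (\<lambda>x. ennreal (p x))) A + emeasure (density M (\<lambda>x. ennreal (q x))) A) / 2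
     = emeasure ?D A" if [measurable]: "A \<in> sets M" for A
  proof -
    have "emeasure ?D A = (\<integral>\<^sup>+x. (ennreal (p x) * indicator A x + ennreal (q x) * indicator A x) / 2 \<partial>M)"
      unfolding emeasure_density[OF _ that, measurable]
      using nonneg
      by (subst emeasure_density)
         (auto intro!: nn_integral_cong split: split_indicator
           simp: divide_ennreal[symmetric] ennreal_numeral[symmetric] simp del: ennreal_numeral)
    also have "\<dots> = (emeasure (density M (\<lambda>x. ennreal (p x))) A + emeasure (density M (\<lambda>x. ennreal (q x))) A) / 2"
      by (subst nn_integral_divide) (auto simp: emeasure_density nn_integral_add)
    finally show ?thesis by simp
  qed
  have "midpoint_measure (density M (\<lambda>x. ennreal (p x))) (density M (\<lambda>x. ennreal (q x)))
      = measure_of (space ?D) (sets ?D) (emeasure ?D)"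
    unfolding midpoint_measure_def space_density sets_density
    using eq by (intro measure_of_eq) (auto simp: sets.space_closed sets.sigma_sets_eq)
  then show ?thesis by (simp only: measure_of_of_measure)
qed

context sigma_finite_measure
begin

text \<open>By \<open>mult_ln_ge\<close> and \<open>mult_ln_le\<close> the integrand lies between
  \<open>(p - q) / 2\<close> and \<open>p\<close>, so \<open>p + q\<close> dominates its absolute
  value.\<close>

lemma integrable_mult_ln:
  fixes p q :: "'a \<Rightarrow> real"
  assumes p: "integrable M p" "\<And>x. x \<in> space M \<Longrightarrow> 0 < p x"
    and q: "integrable M q" "\<And>x. x \<in> space M \<Longrightarrow> 0 < q x"
  shows "integrable M (\<lambda>x. p x * ln (2 * p x / (p x + q x)))"
proof (rule Bochner_Integration.integrable_bound)
  note [measurable] = borel_measurable_integrable[OF p(1)] borel_measurable_integrable[OF q(1)]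
  show "integrable M (\<lambda>x. p x + q x)" using p q by simp
  show "(\<lambda>x. p x * ln (2 * p x / (p x + q x))) \<in> borel_measurable M" by measurable
  show "AE x in M. norm (p x * ln (2 * p x / (p x + q x))) \<le> norm (p x + q x)"
  proof (rule AE_I2)
    fix x assume "x \<in> space M"
    with p q have pos: "0 < p x" "0 < q x" by auto
    have "\<bar>v\<bar> \<le> \<bar>a + b\<bar>" if "(a - b) / 2 \<le> v" "v \<le> a" "0 < a" "0 < b" for a b v :: real
      using that by (auto simp: abs_if field_simps)
    from this[OF mult_ln_ge[OF pos] mult_ln_le[OF pos] pos]
    show "norm (p x * ln (2 * p x / (p x + q x))) \<le> norm (p x + q x)"
      unfolding real_norm_def .
  qed
qed

lemma integrable_js_kernel:
  assumes p: "integrable M p" "\<And>x. x \<in> space M \<Longrightarrow> 0 < p x"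
    and q: "integrable M q" "\<And>x. x \<in> space M \<Longrightarrow> 0 < q x"
  shows "integrable M (\<lambda>x. js_kernel (p x) (q x))"
  using integrable_mult_ln[OF p q] integrable_mult_ln[OF q p]
  by (simp add: js_kernel_def add.commute)

lemma KL_midpoint_density:
  assumes p: "integrable M p" "\<And>x. x \<in> space M \<Longrightarrow> 0 < p x"
    and q: "integrable M q" "\<And>x. x \<in> space M \<Longrightarrow> 0 < q x"
  shows "KL (density M (\<lambda>x. ennreal (p x))) (density M (\<lambda>x. ennreal ((p x + q x) / 2)))
    = (LINT x|M. p x * ln (2 * p x / (p x + q x)))"
proof -
  note [measurable] = borel_measurable_integrable[OF p(1)] borel_measurable_integrable[OF q(1)]
  have "KL (density M (\<lambda>x. ennreal (p x))) (density M (\<lambda>x. ennreal ((p x + q x) / 2)))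
    = (LINT x|M. p x * log (exp 1) (p x / ((p x + q x) / 2)))"
    unfolding KL_def using p(2) q(2)
    by (intro KL_density_density AE_I2) (auto simp: add_pos_pos less_imp_le dest: add_pos_pos[THEN less_imp_neq, THEN not_sym])
  also have "\<dots> = (LINT x|M. p x * ln (2 * p x / (p x + q x)))"
    by (simp add: log_ln mult.commute)
  finally show ?thesis .
qed

lemma JS_density:
  assumes p: "integrable M p" "\<And>x. x \<in> space M \<Longrightarrow> 0 < p x"
    and q: "integrable M q" "\<And>x. x \<in> space M \<Longrightarrow> 0 < q x"
  shows "JS (density M (\<lambda>x. ennreal (p x))) (density M (\<lambda>x. ennreal (q x)))
    = (LINT x|M. js_kernel (p x) (q x)) / 2"
proof -
  note [measurable] = borel_measurable_integrable[OF p(1)] borel_measurable_integrable[OF q(1)]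
  have mid: "midpoint_measure (density M (\<lambda>x. ennreal (p x))) (density M (\<lambda>x. ennreal (q x)))
    = density M (\<lambda>x. ennreal ((p x + q x) / 2))"
    using p(2) q(2) by (intro midpoint_measure_density) (auto intro: less_imp_le)
  show ?thesis
    unfolding JS_def mid
    using KL_midpoint_density[OF p q] KL_midpoint_density[OF q p] integrable_mult_ln[OF p q] integrable_mult_ln[OF q p]
    by (simp add: js_kernel_def add.commute)
qed

text \<open>Minimizing the right-hand side of \<open>js_kernel_triangle_weighted\<close> over \<open>t\<close> only after
  integration replaces Minkowski's inequality.\<close>

lemma sqrt_JS_triangle:
  assumes p: "integrable M p" "\<And>x. x \<in> space M \<Longrightarrow> 0 < p x"
    and q: "integrable M q" "\<And>x. x \<in> space M \<Longrightarrow> 0 < q x"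
    and r: "integrable M r" "\<And>x. x \<in> space M \<Longrightarrow> 0 < r x"
  shows "sqrt (JS (density M (\<lambda>x. ennreal (p x))) (density M (\<lambda>x. ennreal (q x))))
    \<le> sqrt (JS (density M (\<lambda>x. ennreal (p x))) (density M (\<lambda>x. ennreal (r x))))
      + sqrt (JS (density M (\<lambda>x. ennreal (r x))) (density M (\<lambda>x. ennreal (q x))))"
proof -
  define A where "A = (LINT x|M. js_kernel (p x) (r x)) / 2"
  define B where "B = (LINT x|M. js_kernel (r x) (q x)) / 2"
  define C where "C = (LINT x|M. js_kernel (p x) (q x)) / 2"
  have A0: "0 \<le> A" unfolding A_def
    using p(2) r(2) by (auto intro!: integral_nonneg_AE AE_I2 js_kernel_nonneg)
  have B0: "0 \<le> B" unfolding B_def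
    using q(2) r(2) by (auto intro!: integral_nonneg_AE AE_I2 js_kernel_nonneg)
  have le: "C \<le> (1 + t) * A + (1 + 1 / t) * B" if t: "0 < t" for t
  proof -
    have "(LINT x|M. js_kernel (p x) (q x))
        \<le> (LINT x|M. (1 + t) * js_kernel (p x) (r x) + (1 + 1 / t) * js_kernel (r x) (q x))"
      using integrable_js_kernel[OF p q] integrable_js_kernel[OF p r] integrable_js_kernel[OF r q]
        p(2) q(2) r(2) t
      by (intro integral_mono) (auto intro!: js_kernel_triangle_weighted)
    also have "\<dots> = (1 + t) * (LINT x|M. js_kernel (p x) (r x)) + (1 + 1 / t) * (LINT x|M. js_kernel (r x) (q x))"
      using integrable_js_kernel[OF p r] integrable_js_kernel[OF r q] by simp
    finally show ?thesis by (simp add: A_def B_def C_def)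
  qed
  have "sqrt C \<le> sqrt A + sqrt B"
  proof (rule field_le_epsilon)
    fix e :: real assume e: "0 < e"
    \<comment> \<open>The slack \<open>e / 2\<close> keeps \<open>a\<close> and \<open>b\<close>
      positive even if \<open>A\<close> or \<open>B\<close> is 0. The weight
      \<open>t = b / a\<close> minimizes
      \<open>(1 + t) * a\<^sup>2 + (1 + 1 / t) * b\<^sup>2\<close>, with value
      \<open>(a + b)\<^sup>2\<close>.\<close>
    define a b where "a = sqrt A + e / 2" and "b = sqrt B + e / 2"
    have ab: "0 < a" "0 < b" using e A0 B0 by (auto simp: a_def b_def add_nonneg_pos)
    have "A \<le> a\<^sup>2" "B \<le> b\<^sup>2"
      using e A0 B0 by (auto simp: a_def b_def intro!: real_le_rsqrt sqrt_le_D)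
    then have "(1 + b / a) * A + (1 + 1 / (b / a)) * B \<le> (1 + b / a) * a\<^sup>2 + (1 + 1 / (b / a)) * b\<^sup>2"
      using ab by (intro add_mono mult_left_mono) auto
    also have "\<dots> = (a + b)\<^sup>2"
      using ab by (simp add: power2_eq_square field_simps)
    finally have "C \<le> (a + b)\<^sup>2"
      using le[of "b / a"] ab by (auto intro: order_trans)
    then have "sqrt C \<le> a + b"
      using ab by (intro real_le_lsqrt) auto
    then show "sqrt C \<le> sqrt A + sqrt B + e"
      by (simp add: a_def b_def)
  qed
  then show ?thesis
    by (simp add: JS_density[OF p q] JS_density[OF p r] JS_density[OF r q] A_def B_def C_def)
qed

text \<open>Pointwise, \<open>js_kernel_le_sq\<close> and the bound on \<open>p - q\<close> give at
  most \<open>(c m)\<^sup>2 / (4 m) = c\<^sup>2 m / 4\<close>; the factor 1/2 in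
  \<open>JS_density\<close> turns 4 into 8.\<close>

lemma JS_density_le:
  assumes p: "integrable M p" and q: "integrable M q" and m: "integrable M m"
    and pos: "\<And>x. x \<in> space M \<Longrightarrow> 0 < m x"
    and le: "\<And>x. x \<in> space M \<Longrightarrow> m x \<le> p x" "\<And>x. x \<in> space M \<Longrightarrow> m x \<le> q x"
    and diff: "\<And>x. x \<in> space M \<Longrightarrow> \<bar>p x - q x\<bar> \<le> c * m x"
  shows "JS (density M (\<lambda>x. ennreal (p x))) (density M (\<lambda>x. ennreal (q x)))
    \<le> c\<^sup>2 / 8 * (LINT x|M. m x)"
proof -
  have pp: "0 < p x" "0 < q x" if "x \<in> space M" for x
    using pos[OF that] le[OF that] by auto
  have "(LINT x|M. js_kernel (p x) (q x)) \<le> (LINT x|M. c\<^sup>2 / 4 * m x)"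
  proof (rule integral_mono)
    show "integrable M (\<lambda>x. js_kernel (p x) (q x))"
      using p q pp by (intro integrable_js_kernel) auto
    show "integrable M (\<lambda>x. c\<^sup>2 / 4 * m x)" using m by simp
    fix x assume x: "x \<in> space M"
    have "js_kernel (p x) (q x) \<le> (p x - q x)\<^sup>2 / (4 * m x)"
      using x pos le by (intro js_kernel_le_sq) auto
    also have "\<dots> \<le> (c * m x)\<^sup>2 / (4 * m x)"
      using diff[OF x] pos[OF x] by (intro divide_right_mono) (auto simp: abs_le_square_iff[symmetric])
    also have "\<dots> = c\<^sup>2 / 4 * m x"
      using pos[OF x] by (simp add: power2_eq_square)
    finally show "js_kernel (p x) (q x) \<le> c\<^sup>2 / 4 * m x" .
  qed
  then show ?thesis using p q pp by (subst JS_density) auto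
qed

end

section \<open>Total variation and supports\<close>

context
  fixes P Q :: "'a measure"
  assumes P: "prob_space P" and Q: "prob_space Q" and sets_eq: "sets P = sets Q"
begin

lemma measure_diff_le_TV:
  assumes "A \<in> sets P"
  shows "\<bar>measure P A - measure Q A\<bar> \<le> TV P Q"
  unfolding TV_def
proof (rule cSUP_upper[OF assms])
  \<comment> \<open>\<open>TV\<close> is a supremum of reals, which is an upper bound only once the
    family is known to be bounded.\<close>
  have "\<bar>measure P B - measure Q B\<bar> \<le> 1" for B
    using prob_space.prob_le_1[OF P, of B] prob_space.prob_le_1[OF Q, of B]
      measure_nonneg[of P B] measure_nonneg[of Q B] by linarith
  then show "bdd_above ((\<lambda>A. \<bar>measure P A - measure Q A\<bar>) ` sets P)"
    by (auto intro!: bdd_aboveI)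
qed

lemma TV_nonneg: "0 \<le> TV P Q"
  using measure_diff_le_TV[of "{}"] by simp

lemma TV_le_1: "TV P Q \<le> 1"
  unfolding TV_def
proof (rule cSUP_least)
  fix A
  show "\<bar>measure P A - measure Q A\<bar> \<le> 1"
    using prob_space.prob_le_1[OF P, of A] prob_space.prob_le_1[OF Q, of A]
      measure_nonneg[of P A] measure_nonneg[of Q A] by linarith
qed auto

end

section \<open>Layer-cake formula and expectations of bounded functions under two
  distributions\<close>

lemma nn_integral_eq_integral_tail:
  fixes h :: "'a \<Rightarrow> real"
  assumes "sigma_finite_measure P" and [measurable]: "h \<in> borel_measurable P"
    and nonneg: "\<And>x. x \<in> space P \<Longrightarrow> 0 \<le> h x"
  shows "(\<integral>\<^sup>+x. ennreal (h x) \<partial>P)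
    = (\<integral>\<^sup>+t. emeasure P {x \<in> space P. t < h x} * indicator {0..} t \<partial>lborel)"
proof -
  interpret sigma_finite_measure P by fact
  interpret pair_sigma_finite lborel P ..
  let ?K = "\<lambda>x t. if 0 \<le> t \<and> t < h x then 1 else 0 :: ennreal"
  have "(\<integral>\<^sup>+x. ennreal (h x) \<partial>P) = (\<integral>\<^sup>+x. \<integral>\<^sup>+t. ?K x t \<partial>lborel \<partial>P)"
  proof (intro nn_integral_cong)
    fix x assume "x \<in> space P"
    have "(\<integral>\<^sup>+t. ?K x t \<partial>lborel) = (\<integral>\<^sup>+t. indicator {0..<h x} t \<partial>lborel)"
      by (intro nn_integral_cong) (auto split: split_indicator)
    then show "ennreal (h x) = (\<integral>\<^sup>+t. ?K x t \<partial>lborel)"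
      using nonneg[OF \<open>x \<in> space P\<close>] by simp
  qed
  also have "\<dots> = (\<integral>\<^sup>+t. \<integral>\<^sup>+x. ?K x t \<partial>P \<partial>lborel)"
    by (rule Fubini') measurable
  also have "\<dots> = (\<integral>\<^sup>+t. emeasure P {x \<in> space P. t < h x} * indicator {0..} t \<partial>lborel)"
  proof (intro nn_integral_cong)
    fix t :: real
    have "(\<integral>\<^sup>+x. ?K x t \<partial>P) = (\<integral>\<^sup>+x. indicator {0..} t * indicator {x \<in> space P. t < h x} x \<partial>P)"
      by (intro nn_integral_cong) (auto split: split_indicator)
    also have "\<dots> = indicator {0..} t * emeasure P {x \<in> space P. t < h x}"
      by (subst nn_integral_cmult) auto
    finally show "(\<integral>\<^sup>+x. ?K x t \<partial>P) = emeasure P {x \<in> space P. t < h x} * indicator {0..} t"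
      by (simp add: mult.commute)
  qed
  finally show ?thesis .
qed

text \<open>In the layer-cake formula the tail probabilities under \<open>P\<close> and
  \<open>Q\<close> differ by at most \<open>TV P Q\<close> at each level \<open>t\<close>, and both
  vanish above \<open>c\<close>. Only levels in \<open>{0..c}\<close> contribute to the
  error.\<close>

lemma integral_diff_le_TV:
  fixes h :: "'a \<Rightarrow> real"
  assumes P: "prob_space P" and Q: "prob_space Q" and sets_eq: "sets P = sets Q"
    and h [measurable]: "h \<in> borel_measurable P"
    and nonneg: "\<And>x. x \<in> space P \<Longrightarrow> 0 \<le> h x" and le: "\<And>x. x \<in> space P \<Longrightarrow> h x \<le> c"
  shows "(LINT x|P. h x) \<le> (LINT x|Q. h x) + c * TV P Q"
proof -
  interpret P: prob_space P by fact
  interpret Q: prob_space Q by fact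
  have space_eq: "space P = space Q" using sets_eq by (rule sets_eq_imp_space_eq)
  have hQ [measurable]: "h \<in> borel_measurable Q"
    using h by (simp add: measurable_cong_sets[OF sets_eq refl])
  have c: "0 \<le> c" using P.not_empty nonneg le by (meson ex_in_conv order_trans)
  note T0 = TV_nonneg[OF P Q sets_eq]
  have intP: "integrable P h" using nonneg le by (intro P.integrable_const_bound[of _ c]) auto
  have intQ: "integrable Q h"
    using nonneg le by (intro Q.integrable_const_bound[of _ c]) (auto simp: space_eq)
  have "(\<integral>\<^sup>+x. ennreal (h x) \<partial>P)
      = (\<integral>\<^sup>+t. emeasure P {x \<in> space P. t < h x} * indicator {0..} t \<partial>lborel)"
    using nonneg by (intro nn_integral_eq_integral_tail) (auto intro: P.sigma_finite_measure_axioms)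
  also have "\<dots> \<le> (\<integral>\<^sup>+t. emeasure Q {x \<in> space Q. t < h x} * indicator {0..} t
      + ennreal (TV P Q) * indicator {0..c} t \<partial>lborel)"
  proof (intro nn_integral_mono)
    fix t :: real
    let ?A = "{x \<in> space P. t < h x}"
    have "measure P ?A \<le> measure Q ?A + TV P Q"
      using measure_diff_le_TV[OF P Q sets_eq, of ?A] by simp
    then have "emeasure P ?A \<le> emeasure Q ?A + ennreal (TV P Q)"
      using T0 by (simp add: P.emeasure_eq_measure Q.emeasure_eq_measure flip: ennreal_plus)
    moreover have "?A = {}" if "c < t" using le that by fastforce
    ultimately have *: "emeasure P ?A \<le> (if c < t then 0 else emeasure Q ?A + ennreal (TV P Q))"
      by (cases "c < t") (simp_all del: Collect_empty_eq)
    show "emeasure P ?A * indicator {0..} t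
        \<le> emeasure Q {x \<in> space Q. t < h x} * indicator {0..} t + ennreal (TV P Q) * indicator {0..c} t"
      unfolding space_eq[symmetric] using * by (auto split: split_indicator if_splits)
  qed
  also have "\<dots> = (\<integral>\<^sup>+t. emeasure Q {x \<in> space Q. t < h x} * indicator {0..} t \<partial>lborel)
      + ennreal (TV P Q) * ennreal c"
    using c by (subst nn_integral_add) (auto simp: nn_integral_cmult)
  also have "(\<integral>\<^sup>+t. emeasure Q {x \<in> space Q. t < h x} * indicator {0..} t \<partial>lborel)
      = (\<integral>\<^sup>+x. ennreal (h x) \<partial>Q)"
    using nonneg by (intro nn_integral_eq_integral_tail[symmetric])
      (auto intro: Q.sigma_finite_measure_axioms simp: space_eq)
  also have "(\<integral>\<^sup>+x. ennreal (h x) \<partial>Q) = ennreal (LINT x|Q. h x)"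
    using nonneg by (intro nn_integral_eq_integral[OF intQ] AE_I2) (simp add: space_eq)
  also have "(\<integral>\<^sup>+x. ennreal (h x) \<partial>P) = ennreal (LINT x|P. h x)"
    using nonneg by (intro nn_integral_eq_integral[OF intP] AE_I2)
  finally have le': "ennreal (LINT x|P. h x) \<le> ennreal (LINT x|Q. h x) + ennreal (TV P Q) * ennreal c" .
  have Q0: "0 \<le> (LINT x|Q. h x)"
    using nonneg by (intro integral_nonneg_AE AE_I2) (simp add: space_eq)
  note le'
  also have "ennreal (LINT x|Q. h x) + ennreal (TV P Q) * ennreal c
      = ennreal ((LINT x|Q. h x) + TV P Q * c)"
    using c T0 Q0 by (simp add: ennreal_mult)
  finally show ?thesis
    using c T0 Q0 by (subst (asm) ennreal_le_iff) (auto simp: mult.commute)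
qed

lemma abs_integral_diff_le_TV:
  fixes h :: "'a \<Rightarrow> real"
  assumes P: "prob_space P" and Q: "prob_space Q" and sets_eq: "sets P = sets Q"
    and h: "h \<in> borel_measurable P"
    and nonneg: "\<And>x. x \<in> space P \<Longrightarrow> 0 \<le> h x" and le: "\<And>x. x \<in> space P \<Longrightarrow> h x \<le> c"
  shows "\<bar>(LINT x|P. h x) - (LINT x|Q. h x)\<bar> \<le> c * TV P Q"
proof -
  have space_eq: "space P = space Q" using sets_eq by (rule sets_eq_imp_space_eq)
  have hQ: "h \<in> borel_measurable Q"
    using h by (simp add: measurable_cong_sets[OF sets_eq refl])
  have TV_commute: "TV Q P = TV P Q"
    unfolding TV_def sets_eq by (intro SUP_cong refl) (rule abs_minus_commute)
  have "(LINT x|P. h x) \<le> (LINT x|Q. h x) + c * TV P Q"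
    using P Q sets_eq h nonneg le by (rule integral_diff_le_TV)
  moreover have "(LINT x|Q. h x) \<le> (LINT x|P. h x) + c * TV Q P"
    using nonneg le by (intro integral_diff_le_TV[OF Q P sets_eq[symmetric] hQ]) (auto simp: space_eq)
  ultimately show ?thesis by (simp add: TV_commute abs_le_iff)
qed

section \<open>Supports of Borel measures\<close>

lemma closed_measure_supp: "closed (measure_supp P)"
proof -
  have "- measure_supp P = \<Union>{V. open V \<and> emeasure P V = 0}"
    by (auto simp: measure_supp_def zero_less_iff_neq_zero)
  then have "open (- measure_supp P)" by (simp only: open_Union mem_Collect_eq) auto
  then show ?thesis by (simp add: closed_def)
qed

text \<open>Every point outside the support lies in a null set from a fixed countable basis, and a
  countable union of null sets is null.\<close>

lemma AE_in_measure_supp: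
  fixes P :: "'a::second_countable_topology measure"
  assumes "sets P = sets borel"
  shows "AE x in P. x \<in> measure_supp P"
proof -
  obtain B :: "'a set set" where B: "countable B" "topological_basis B"
    using ex_countable_basis by auto
  define N where "N = {V \<in> B. emeasure P V = 0}"
  have "(\<Union>V\<in>N. V) \<in> null_sets P"
  proof (rule null_sets_UN')
    show "countable N" using B(1) by (auto simp: N_def)
    fix V assume "V \<in> N"
    then show "V \<in> null_sets P"
      using topological_basis_open[OF B(2)] assms by (auto simp: N_def null_sets_def)
  qed
  then have "AE x in P. x \<notin> (\<Union>V\<in>N. V)" by (rule AE_not_in)
  then show ?thesis
  proof eventually_elim
    case (elim x)
    show ?case unfolding measure_supp_def
    proof (intro CollectI allI impI, rule ccontr)
      fix V assume V: "open V" "x \<in> V" and "\<not> 0 < emeasure P V"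
      then have "emeasure P V = 0" by (simp add: zero_less_iff_neq_zero)
      obtain B' where B': "B' \<subseteq> B" "\<Union>B' = V"
        using B(2) V(1) unfolding topological_basis_def by meson
      then obtain U where U: "U \<in> B'" "x \<in> U" using V(2) by auto
      have "emeasure P U = 0"
      proof (rule emeasure_eq_0)
        show "V \<in> sets P" using V(1) assms by simp
        show "emeasure P V = 0" by fact
        show "U \<subseteq> V" using U(1) B'(2) by auto
      qed
      with U(1) B'(1) have "U \<in> N" by (auto simp: N_def)
      with U(2) elim show False by auto
    qed
  qed
qed

section \<open>Privacy leakage\<close>

context fl_setting
begin

context
  fixes k assumes k: "k \<in> {1..num_clients S}"
begin

section \<open>Data space, prior and belief ratio of one client\<close>

lemma space_data_measure: "space (data_measure S k) = data_supp S k"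
  by (auto simp: data_measure_def data_supp_def space_restrict_space)

lemma integrable_prior: "integrable (data_measure S k) (prior S k)"
  and integral_prior: "(LINT d|data_measure S k. prior S k d) = 1"
proof -
  note [measurable] = prior_measurable[OF k]
  have nonneg: "AE d in data_measure S k. 0 \<le> prior S k d"
    using prior_pos[OF k] by (intro AE_I2) (auto simp: space_data_measure less_imp_le)
  have one: "(\<integral>\<^sup>+d. ennreal (prior S k d) \<partial>data_measure S k) = ennreal 1"
    using prob_space.emeasure_space_1[OF prior_density[OF k]]
    by (simp add: emeasure_density nn_set_integral_space)
  show "integrable (data_measure S k) (prior S k)"
    using one nonneg by (intro integrableI_nn_integral_finite[where x=1]) auto
  show "(LINT d|data_measure S k. prior S k d) = 1"
    using integral_eq_nn_integral[OF _ nonneg] one by simp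
qed

text \<open>The reference measure itself need not be sigma-finite. The data measure is, since it has
  density \<open>1 / prior\<close> with respect to a probability measure.\<close>

lemma sigma_finite_data_measure: "sigma_finite_measure (data_measure S k)"
proof -
  let ?M = "data_measure S k" and ?f = "\<lambda>d. ennreal (prior S k d)"
  note [measurable] = prior_measurable[OF k]
  interpret N: prob_space "density ?M ?f" by (rule prior_density[OF k])
  have "density (density ?M ?f) (\<lambda>d. ennreal (1 / prior S k d)) = density ?M (\<lambda>d. ?f d * ennreal (1 / prior S k d))"
    by (rule density_density_eq) auto
  also have "\<dots> = density ?M (\<lambda>d. 1)"
  proof (intro density_cong AE_I2)
    fix d assume "d \<in> space ?M"
    then have "0 < prior S k d" using prior_pos[OF k] by (simp add: space_data_measure)
    then show "?f d * ennreal (1 / prior S k d) = 1" by (simp flip: ennreal_mult)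
  qed auto
  also have "\<dots> = ?M" by (rule density_1)
  finally have "density (density ?M ?f) (\<lambda>d. ennreal (1 / prior S k d)) = ?M" .
  moreover have "sigma_finite_measure (density (density ?M ?f) (\<lambda>d. ennreal (1 / prior S k d)))"
    by (subst N.sigma_finite_iff_density_finite) auto
  ultimately show ?thesis by simp
qed

lemma W_borel [measurable]: "W S k \<in> sets borel"
  unfolding W_def by (intro borel_closed closed_Un closed_measure_supp)

lemma abs_log_ratio_le_xi:
  assumes "w \<in> W S k" "d \<in> data_supp S k"
  shows "\<bar>ln (posterior S k w d / prior S k d)\<bar> \<le> xi S"
proof -
  have "\<bar>ln (posterior S k w d / prior S k d)\<bar> \<le> xi_client S k"
    unfolding xi_client_def
    using assms cSUP_upper[OF _ log_ratio_bounded[OF k], of "(w, d)"] by simp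
  also have "\<dots> \<le> xi S"
    unfolding xi_def using k by (intro Max_ge) auto
  finally show ?thesis .
qed

lemma posterior_bounds:
  assumes w: "w \<in> W S k" and d: "d \<in> data_supp S k"
  shows "exp (- xi S) * prior S k d \<le> posterior S k w d"
    and "posterior S k w d \<le> exp (xi S) * prior S k d"
proof -
  let ?r = "posterior S k w d / prior S k d"
  have pos: "0 < prior S k d" "0 < posterior S k w d"
    using prior_pos[OF k d] posterior_pos[OF k w d] by auto
  have "exp (- xi S) \<le> exp (ln ?r)" "exp (ln ?r) \<le> exp (xi S)"
    using abs_log_ratio_le_xi[OF w d] by (simp_all only: exp_le_cancel_iff abs_le_iff) auto
  moreover have "exp (ln ?r) = ?r" using pos by simp
  ultimately show "exp (- xi S) * prior S k d \<le> posterior S k w d"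
    "posterior S k w d \<le> exp (xi S) * prior S k d"
    using pos by (simp_all add: field_simps)
qed

text \<open>The section at \<open>d\<close> of the jointly measurable posterior is measurable on
  \<open>W S k\<close>; the indicator extends it by zero to the whole space.\<close>

lemma posterior_measurable_W:
  assumes d: "d \<in> data_supp S k"
  shows "(\<lambda>w. indicator (W S k) w * posterior S k w d) \<in> borel_measurable borel"
proof -
  have "(\<lambda>w. posterior S k w d) \<in> borel_measurable (restrict_space borel (W S k))"
    using measurable_Pair1[OF posterior_measurable[OF k], of d] d by (simp add: space_data_measure)
  then show ?thesis
    by (subst (asm) borel_measurable_restrict_space_iff) auto
qed

section \<open>Mixtures of posteriors over an arbitrary distribution concentrated on
  \<open>W S k\<close>, to be instantiated with \<open>P_O S k\<close> and
  \<open>P_S S k\<close>\<close>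

context
  fixes P :: "(real ^ 'n) measure"
  assumes P: "prob_space P" and sets_P: "sets P = sets borel" and AE_W: "AE w in P. w \<in> W S k"
begin

lemma integrable_posterior:
  assumes d: "d \<in> data_supp S k"
  shows "integrable P (\<lambda>w. indicator (W S k) w * posterior S k w d)"
proof -
  interpret prob_space P by fact
  have "AE w in P. norm (indicator (W S k) w * posterior S k w d) \<le> exp (xi S) * prior S k d"
    using AE_W
  proof eventually_elim
    case (elim w)
    then show ?case using posterior_bounds[OF elim d] posterior_pos[OF k elim d] by simp
  qed
  then show ?thesis
    using posterior_measurable_W[OF d]
    by (intro integrable_const_bound) (auto simp: measurable_cong_sets[OF sets_P refl])
qed

lemma mixture_ge:
  assumes d: "d \<in> data_supp S k"
  shows "exp (- xi S) * prior S k d \<le> (LINT w:W S k|P. posterior S k w d)"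
proof -
  have "AE w in P. exp (- xi S) * prior S k d \<le> indicator (W S k) w * posterior S k w d"
    using AE_W by eventually_elim (use posterior_bounds[OF _ d] in simp)
  then show ?thesis
    unfolding set_lebesgue_integral_def real_scaleR_def
    by (intro prob_space.integral_ge_const[OF P integrable_posterior[OF d]])
qed

lemma mixture_le:
  assumes d: "d \<in> data_supp S k"
  shows "(LINT w:W S k|P. posterior S k w d) \<le> exp (xi S) * prior S k d"
proof -
  have "AE w in P. indicator (W S k) w * posterior S k w d \<le> exp (xi S) * prior S k d"
    using AE_W by eventually_elim (use posterior_bounds[OF _ d] in simp)
  then show ?thesis
    unfolding set_lebesgue_integral_def real_scaleR_def
    by (intro prob_space.integral_le_const[OF P integrable_posterior[OF d]])
qed

text \<open>Joint measurability is available on \<open>W S k\<close> times the data space, so the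
  parameter integral is formed over \<open>P\<close> restricted to \<open>W S k\<close>, which is
  still a finite measure.\<close>

lemma mixture_measurable:
  "(\<lambda>d. LINT w:W S k|P. posterior S k w d) \<in> borel_measurable (data_measure S k)"
proof -
  interpret prob_space P by fact
  let ?R = "restrict_space P (W S k)"
  have W_P: "W S k \<in> sets P" using W_borel sets_P by simp
  interpret R: finite_measure ?R
    using W_P by (intro finite_measure_restrict_space) auto
  have "sets ?R = sets (restrict_space borel (W S k))"
    using sets_P by (rule sets_restrict_space_cong)
  then have eq: "sets (?R \<Otimes>\<^sub>M data_measure S k) = sets (restrict_space borel (W S k) \<Otimes>\<^sub>M data_measure S k)"
    by (intro sets_pair_measure_cong refl)
  have meas: "(\<lambda>(w, d). posterior S k w d) \<in> borel_measurable (?R \<Otimes>\<^sub>M data_measure S k)"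
    using posterior_measurable[OF k] by (simp only: measurable_cong_sets[OF eq refl])
  have "(\<lambda>(d, w). posterior S k w d) \<in> borel_measurable (data_measure S k \<Otimes>\<^sub>M ?R)"
    using measurable_pair_swap[OF meas] by (simp add: case_prod_unfold)
  then have "(\<lambda>d. LINT w|?R. posterior S k w d) \<in> borel_measurable (data_measure S k)"
    by (rule R.borel_measurable_lebesgue_integral)
  moreover have "(LINT w|?R. posterior S k w d) = (LINT w:W S k|P. posterior S k w d)" for d
    using W_P by (subst integral_restrict_space) (auto simp: set_lebesgue_integral_def)
  ultimately show ?thesis by simp
qed

lemma mixture_pos:
  assumes d: "d \<in> data_supp S k"
  shows "0 < (LINT w:W S k|P. posterior S k w d)"
proof -
  have "0 < exp (- xi S) * prior S k d" using prior_pos[OF k d] by simp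
  also note mixture_ge[OF d]
  finally show ?thesis .
qed

lemma integrable_mixture:
  "integrable (data_measure S k) (\<lambda>d. LINT w:W S k|P. posterior S k w d)"
proof (rule Bochner_Integration.integrable_bound)
  show "integrable (data_measure S k) (\<lambda>d. exp (xi S) * prior S k d)"
    using integrable_prior by simp
  show "AE d in data_measure S k. norm (LINT w:W S k|P. posterior S k w d) \<le> norm (exp (xi S) * prior S k d)"
  proof (rule AE_I2)
    fix d assume "d \<in> space (data_measure S k)"
    then have d: "d \<in> data_supp S k" by (simp add: space_data_measure)
    show "norm (LINT w:W S k|P. posterior S k w d) \<le> norm (exp (xi S) * prior S k d)"
      using mixture_pos[OF d] mixture_le[OF d] by simp
  qed
qed (rule mixture_measurable)

end

section \<open>Comparison of the unprotected and protected mixtures of one client\<close>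

lemma AE_P_O_W: "AE w in P_O S k. w \<in> W S k"
  using AE_in_measure_supp[OF P_O(2)[OF k]] by eventually_elim (simp add: W_def)

lemma AE_P_S_W: "AE w in P_S S k. w \<in> W S k"
  using AE_in_measure_supp[OF P_S(2)[OF k]] by eventually_elim (simp add: W_def)

lemma W_nonempty: "W S k \<noteq> {}"
proof
  assume "W S k = {}"
  with AE_P_O_W have "AE w in P_O S k. False" by simp
  then show False using prob_space.AE_False[OF P_O(1)[OF k]] by simp
qed

lemma data_supp_nonempty: "data_supp S k \<noteq> {}"
  using prob_space.not_empty[OF prior_density[OF k]] by (simp add: space_data_measure)

lemma xi_nonneg: "0 \<le> xi S"
proof -
  obtain w d where "w \<in> W S k" "d \<in> data_supp S k"
    using W_nonempty data_supp_nonempty by blast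
  then have "\<bar>ln (posterior S k w d / prior S k d)\<bar> \<le> xi S" by (rule abs_log_ratio_le_xi)
  then show ?thesis by linarith
qed

lemma TV_client_nonneg: "0 \<le> TV (P_O S k) (P_S S k)"
  using P_O[OF k] P_S[OF k] by (intro TV_nonneg) auto

text \<open>Subtracting the constant \<open>m = exp (- xi S) * prior S k d\<close> from the
  posterior leaves the difference of the two mixtures unchanged, because both distributions give
  \<open>W S k\<close> mass 1. The shifted posterior ranges over an interval from 0 of length
  \<open>(exp (2 * xi S) - 1) * m\<close>, so the total variation bound applies with that
  constant.\<close>

lemma abs_mixture_diff_le:
  assumes d: "d \<in> data_supp S k"
  shows "\<bar>(LINT w:W S k|P_O S k. posterior S k w d) - (LINT w:W S k|P_S S k. posterior S k w d)\<bar>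
    \<le> ((exp (2 * xi S) - 1) * TV (P_O S k) (P_S S k)) * (exp (- xi S) * prior S k d)"
proof -
  define m where "m = exp (- xi S) * prior S k d"
  \<comment> \<open>The indicator makes the bounds on \<open>h\<close> hold at every point of the
    space, as \<open>abs_integral_diff_le_TV\<close> demands, and not only almost
    everywhere.\<close>
  define h where "h w = indicator (W S k) w * (posterior S k w d - m)" for w
  have h_eq: "h w = indicator (W S k) w * posterior S k w d - m * indicator (W S k) w" for w
    by (simp add: h_def algebra_simps)
  have m2: "exp (2 * xi S) * m = exp (xi S) * prior S k d"
    by (simp add: m_def mult.assoc[symmetric] exp_add[symmetric])
  have h_meas: "h \<in> borel_measurable (P_O S k)"
  proof -
    have "h = (\<lambda>w. indicator (W S k) w * posterior S k w d - m * indicator (W S k) w)"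
      using h_eq by (rule ext)
    also have "\<dots> \<in> borel_measurable borel"
      by (intro borel_measurable_diff posterior_measurable_W[OF d] borel_measurable_times
            borel_measurable_const borel_measurable_indicator W_borel)
    finally show ?thesis by (simp only: measurable_cong_sets[OF P_O(2)[OF k] refl])
  qed
  have h_nonneg: "0 \<le> h w" for w
    using posterior_bounds(1)[OF _ d] by (auto simp: h_def m_def split: split_indicator)
  have h_le: "h w \<le> (exp (2 * xi S) - 1) * m" for w
  proof (cases "w \<in> W S k")
    case True
    then show ?thesis using posterior_bounds(2)[OF True d] m2 by (simp add: h_def algebra_simps)
  next
    case False
    have "0 \<le> m" using prior_pos[OF k d] by (simp add: m_def)
    with False show ?thesis using xi_nonneg by (simp add: h_def)
  qed
  have int_h: "(LINT w|P. h w) = (LINT w:W S k|P. posterior S k w d) - m"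
    if P: "prob_space P" "sets P = sets borel" "AE w in P. w \<in> W S k" for P
  proof -
    interpret prob_space P by fact
    have "prob (W S k) = 1"
      using that W_borel by (intro prob_eq_1[THEN iffD2]) auto
    moreover have "integrable P (indicator (W S k) :: _ \<Rightarrow> real)"
      using that W_borel by (intro integrable_real_indicator) (auto simp: less_top[symmetric])
    ultimately show ?thesis
      unfolding h_eq set_lebesgue_integral_def real_scaleR_def
      using integrable_posterior[OF that d] that(2) W_borel
      by (subst Bochner_Integration.integral_diff) auto
  qed
  have "(LINT w:W S k|P_O S k. posterior S k w d) - (LINT w:W S k|P_S S k. posterior S k w d)
      = (LINT w|P_O S k. h w) - (LINT w|P_S S k. h w)"
    using int_h[OF P_O[OF k] AE_P_O_W] int_h[OF P_S[OF k] AE_P_S_W] by linarith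
  also have "\<bar>\<dots>\<bar> \<le> ((exp (2 * xi S) - 1) * m) * TV (P_O S k) (P_S S k)"
    using P_O(1)[OF k] P_S(1)[OF k] trans[OF P_O(2)[OF k] P_S(2)[OF k, symmetric]] h_meas h_nonneg h_le
    by (rule abs_integral_diff_le_TV)
  also have "\<dots> = ((exp (2 * xi S) - 1) * TV (P_O S k) (P_S S k)) * m"
    by simp
  finally show ?thesis unfolding m_def .
qed

text \<open>The factor \<open>3 / 8 \<ge> 1 / sqrt 8\<close> instead of \<open>1 / 2\<close> is what makes the second bound of the
  theorem hold for three clients.\<close>

lemma sqrt_JS_F_O_F_A_le:
  "sqrt (JS (F_O S k) (F_A S k)) \<le> 3 / 8 * ((exp (2 * xi S) - 1) * TV (P_O S k) (P_S S k))"
proof -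
  interpret sigma_finite_measure "data_measure S k" by (rule sigma_finite_data_measure)
  define c where "c = (exp (2 * xi S) - 1) * TV (P_O S k) (P_S S k)"
  have c: "0 \<le> c" using xi_nonneg TV_client_nonneg by (simp add: c_def)
  have "JS (F_O S k) (F_A S k) \<le> c\<^sup>2 / 8 * (LINT d|data_measure S k. exp (- xi S) * prior S k d)"
    unfolding F_O_def F_A_def
  proof (rule JS_density_le)
    show "integrable (data_measure S k) (\<lambda>d. LINT w:W S k|P_O S k. posterior S k w d)"
      by (rule integrable_mixture[OF P_O[OF k] AE_P_O_W])
    show "integrable (data_measure S k) (\<lambda>d. LINT w:W S k|P_S S k. posterior S k w d)"
      by (rule integrable_mixture[OF P_S[OF k] AE_P_S_W])
    show "integrable (data_measure S k) (\<lambda>d. exp (- xi S) * prior S k d)"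
      using integrable_prior by simp
    fix d assume "d \<in> space (data_measure S k)"
    then have d: "d \<in> data_supp S k" by (simp add: space_data_measure)
    show "0 < exp (- xi S) * prior S k d" using prior_pos[OF k d] by simp
    show "exp (- xi S) * prior S k d \<le> (LINT w:W S k|P_O S k. posterior S k w d)"
      by (rule mixture_ge[OF P_O[OF k] AE_P_O_W d])
    show "exp (- xi S) * prior S k d \<le> (LINT w:W S k|P_S S k. posterior S k w d)"
      by (rule mixture_ge[OF P_S[OF k] AE_P_S_W d])
    show "\<bar>(LINT w:W S k|P_O S k. posterior S k w d) - (LINT w:W S k|P_S S k. posterior S k w d)\<bar>
      \<le> c * (exp (- xi S) * prior S k d)"
      unfolding c_def by (rule abs_mixture_diff_le[OF d])
  qed
  also have "\<dots> = c\<^sup>2 / 8 * exp (- xi S)"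
    using integral_prior by simp
  also have "\<dots> \<le> c\<^sup>2 / 8 * 1"
    using xi_nonneg by (intro mult_left_mono) auto
  \<comment> \<open>This is \<open>1 / 8 \<le> 9 / 64\<close>.\<close>
  also have "\<dots> \<le> (3 / 8 * c)\<^sup>2"
    by (simp add: power2_eq_square)
  finally have "sqrt (JS (F_O S k) (F_A S k)) \<le> 3 / 8 * c"
    using c by (intro real_le_lsqrt) auto
  then show ?thesis by (simp add: c_def)
qed

text \<open>Triangle inequality through \<open>F_A S k\<close>: the leg from \<open>F_A\<close> to
  \<open>F_B\<close> is the privacy leakage, the leg from \<open>F_O\<close> to \<open>F_A\<close>
  has just been bounded.\<close>

lemma client_leakage_le:
  "sqrt (JS (F_O S k) (F_B S k))
    \<le> eps_p_client S k + 3 / 8 * ((exp (2 * xi S) - 1) * TV (P_O S k) (P_S S k))"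
proof -
  interpret sigma_finite_measure "data_measure S k" by (rule sigma_finite_data_measure)
  have "sqrt (JS (F_O S k) (F_B S k)) \<le> sqrt (JS (F_O S k) (F_A S k)) + sqrt (JS (F_A S k) (F_B S k))"
    unfolding F_O_def F_A_def F_B_def
    by (intro sqrt_JS_triangle integrable_mixture[OF P_O[OF k] AE_P_O_W] mixture_pos[OF P_O[OF k] AE_P_O_W]
          integrable_mixture[OF P_S[OF k] AE_P_S_W] mixture_pos[OF P_S[OF k] AE_P_S_W]
          integrable_prior prior_pos[OF k]; simp only: space_data_measure)
  then show ?thesis using sqrt_JS_F_O_F_A_le by (simp add: eps_p_client_def)
qed

end

text \<open>Common source of both bounds of the theorem: the first relaxes 3/8 to 1/2, the second
  spends 3/8 together with the division by the number of clients.\<close>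

lemma C1_le:
  "C1 S \<le> eps_p S + 3 / 8 * (exp (2 * xi S) - 1) / real (num_clients S)
    * (\<Sum>k=1..num_clients S. TV (P_O S k) (P_S S k))"
proof -
  let ?K = "{1..num_clients S}" and ?T = "\<lambda>k. TV (P_O S k) (P_S S k)"
  have "(\<Sum>k\<in>?K. sqrt (JS (F_O S k) (F_B S k)))
      \<le> (\<Sum>k\<in>?K. eps_p_client S k + 3 / 8 * ((exp (2 * xi S) - 1) * ?T k))"
    by (rule sum_mono) (rule client_leakage_le)
  also have "\<dots> = (\<Sum>k\<in>?K. eps_p_client S k) + 3 / 8 * (exp (2 * xi S) - 1) * (\<Sum>k\<in>?K. ?T k)"
    by (simp only: sum.distrib sum_distrib_left mult.assoc)
  finally show ?thesis
    using clients by (simp add: C1_def eps_p_def field_simps)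
qed

end

section \<open>Utility loss\<close>

context fl_setting
begin

lemma integrable_avg_utility:
  "integrable (Pa_O S) (avg_utility S)" "integrable (Pa_S S) (avg_utility S)"
  unfolding avg_utility_def
  by (intro integrable_mult_right Bochner_Integration.integrable_sum client_utility_integrable; simp)+

lemma eps_u_eq: "eps_u S = (LINT w|Pa_O S. avg_utility S w) - (LINT w|Pa_S S. avg_utility S w)"
  unfolding eps_u_def client_utility_dist_def avg_utility_def
  using client_utility_integrable
  by (simp add: Bochner_Integration.integral_sum sum_subtractf right_diff_distrib)

lemma sets_Pa_S: "sets (Pa_S S) = sets borel"
  by (simp add: Pa_S_def)

lemma AE_Wa_O: "AE w in Pa_O S. w \<in> Wa_O S"
  unfolding Wa_O_def by (rule AE_in_measure_supp[OF Pa_O(2)])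

lemma AE_Wa_S: "AE w in Pa_S S. w \<in> Wa_S S"
  unfolding Wa_S_def by (rule AE_in_measure_supp[OF sets_Pa_S])

lemma TV_agg_le_1: "TV (Pa_O S) (Pa_S S) \<le> 1"
  using Pa_O Pa_S sets_Pa_S by (intro TV_le_1) auto

text \<open>Turns the Lebesgue integral in \<open>is_Delta\<close> into a probability under the
  protected model.\<close>

lemma measure_Pa_S:
  assumes [measurable]: "A \<in> sets borel"
  shows "measure (Pa_S S) A = (LINT w|lborel. pa_S S w * indicator A w)"
proof -
  interpret prob_space "Pa_S S" by (rule Pa_S)
  note [measurable] = pa_S(1)
  have "measure (Pa_S S) A = (LINT w|Pa_S S. indicator A w)"
    using assms sets_Pa_S by (simp add: sets_eq_imp_space_eq)
  also have "\<dots> = (LINT w|lborel. pa_S S w * indicator A w)"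
    unfolding Pa_S_def using pa_S(2) by (subst integral_density) auto
  finally show ?thesis .
qed

text \<open>A Markov-type estimate. The gap \<open>u - avg_utility S w\<close> to the optimal value
  is nonnegative on \<open>Wa_S S\<close>, and there it exceeds \<open>\<Delta>\<close> off
  \<open>W_near S \<Delta>\<close>, a set of protected probability at most half the total variation
  distance.\<close>

lemma eps_u_ge:
  assumes conv: "Wa_O S \<subseteq> W_opt S" and \<Delta>: "is_Delta S \<Delta>"
  shows "\<Delta> * (1 - TV (Pa_O S) (Pa_S S) / 2) \<le> eps_u S"
proof -
  interpret O: prob_space "Pa_O S" by (rule Pa_O(1))
  interpret S: prob_space "Pa_S S" by (rule Pa_S)
  have space_S: "space (Pa_S S) = UNIV"
    using sets_eq_imp_space_eq[OF sets_Pa_S] by simp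
  \<comment> \<open>The support of a probability measure is nonempty, so the convergence inclusion
    yields an actual maximizer \<open>w0\<close>. With no maximizer, the condition in
    \<open>W_near\<close> would be vacuous.\<close>
  have "Wa_O S \<noteq> {}"
  proof
    assume "Wa_O S = {}"
    with AE_Wa_O have "AE w in Pa_O S. False" by simp
    then show False using O.AE_False by simp
  qed
  then obtain w0 where w0: "w0 \<in> W_opt S" using conv by auto
  define u where "u = avg_utility S w0"
  have le_u: "avg_utility S w \<le> u" if "w \<in> Wa S" for w
    using w0 that unfolding W_opt_def is_arg_max_def u_def by (auto simp: not_less)
  have eq_u: "avg_utility S w = u" if "w \<in> W_opt S" for w
    using w0 that le_u unfolding W_opt_def is_arg_max_def u_def by (fastforce simp: not_less)
  \<comment> \<open>All maximizers share the value \<open>u\<close>, which no point of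
    \<open>Wa_S S\<close> exceeds; so the quantifier and the absolute value both disappear.\<close>
  have near: "W_near S \<Delta> = Wa_S S \<inter> {w. u - avg_utility S w \<le> \<Delta>}"
  proof -
    have "w \<in> W_near S \<Delta> \<longleftrightarrow> w \<in> Wa_S S \<and> u - avg_utility S w \<le> \<Delta>" for w
    proof (cases "w \<in> Wa_S S")
      case True
      then have "avg_utility S w \<le> u" using le_u by (simp add: Wa_def)
      then show ?thesis using True w0 eq_u by (auto simp: W_near_def)
    qed (simp add: W_near_def)
    then show ?thesis by auto
  qed
  have avg_meas: "avg_utility S \<in> borel_measurable borel"
    using borel_measurable_integrable[OF integrable_avg_utility(2)]
    by (simp only: measurable_cong_sets[OF sets_Pa_S refl])
  have near_borel: "W_near S \<Delta> \<in> sets borel"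
  proof -
    have "{w \<in> space borel. u - avg_utility S w \<le> \<Delta>} \<in> sets borel"
      using avg_meas by measurable
    moreover have "Wa_S S \<in> sets borel"
      unfolding Wa_S_def by (intro borel_closed closed_measure_supp)
    ultimately show ?thesis unfolding near by (intro sets.Int) auto
  qed
  have \<Delta>_nonneg: "0 \<le> \<Delta>" using \<Delta> by (simp add: is_Delta_def is_arg_max_def)
  \<comment> \<open>\<open>W_near S \<Delta>\<close> is contained in \<open>Wa_S S\<close>, so its
    indicator absorbs the restriction of the domain.\<close>
  have "(LINT w:Wa_S S|lborel. pa_S S w * indicat_real (W_near S \<Delta>) w)
      = (LINT w|lborel. pa_S S w * indicator (W_near S \<Delta>) w)"
    unfolding set_lebesgue_integral_def
    by (intro Bochner_Integration.integral_cong) (auto simp: W_near_def split: split_indicator)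
  then have near_le: "measure (Pa_S S) (W_near S \<Delta>) \<le> TV (Pa_O S) (Pa_S S) / 2"
    using \<Delta> near_borel by (simp add: measure_Pa_S is_Delta_def is_arg_max_def)
  have int_O: "(LINT w|Pa_O S. avg_utility S w) = u"
  proof -
    have "AE w in Pa_O S. avg_utility S w = u"
      using AE_Wa_O by eventually_elim (use conv eq_u in auto)
    then have "(LINT w|Pa_O S. avg_utility S w) = (LINT w|Pa_O S. u)"
      using integrable_avg_utility(1) by (intro integral_cong_AE) auto
    then show ?thesis by (simp add: O.prob_space)
  qed
  let ?far = "space (Pa_S S) - W_near S \<Delta>"
  have far: "?far \<in> sets (Pa_S S)" using near_borel sets_Pa_S by auto
  have "\<Delta> * (1 - TV (Pa_O S) (Pa_S S) / 2) \<le> \<Delta> * measure (Pa_S S) ?far"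
    using near_le \<Delta>_nonneg near_borel sets_Pa_S by (intro mult_left_mono) (auto simp: S.prob_compl)
  also have "\<dots> = (LINT w|Pa_S S. \<Delta> * indicator ?far w)"
    using far by simp
  also have "\<dots> \<le> (LINT w|Pa_S S. u - avg_utility S w)"
  proof (rule integral_mono_AE)
    show "integrable (Pa_S S) (\<lambda>w. \<Delta> * indicator ?far w)"
      using far by (intro integrable_mult_right integrable_real_indicator) (auto simp: less_top[symmetric])
    show "integrable (Pa_S S) (\<lambda>w. u - avg_utility S w)"
      using integrable_avg_utility(2) by simp
    show "AE w in Pa_S S. \<Delta> * indicator ?far w \<le> u - avg_utility S w"
      using AE_Wa_S
    proof eventually_elim
      case (elim w)
      then have "avg_utility S w \<le> u" using le_u by (simp add: Wa_def)
      then show ?case using elim by (auto simp: near split: split_indicator)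
    qed
  qed
  also have "\<dots> = eps_u S"
    using integrable_avg_utility(2) by (simp add: eps_u_eq int_O S.prob_space)
  finally show ?thesis .
qed

end

theorem theorem4p1:
  fixes S :: "('o, 'z, 'n::finite) fl_system"
  assumes "fl_setting S"
  shows "C1 S \<le> eps_p S + 1 / real (num_clients S) *
           (\<Sum>k=1..num_clients S. 1 / 2 * (exp (2 * xi S) - 1) * TV (P_O S k) (P_S S k))
       \<and> (\<forall>\<Delta>. 3 \<le> num_clients S \<longrightarrow> Wa_O S \<subseteq> W_opt S \<longrightarrow> 0 < TV (Pa_O S) (Pa_S S) \<longrightarrow>
             is_Delta S \<Delta> \<longrightarrow> 0 < \<Delta> \<longrightarrow> C1 S \<le> eps_p S + C2 S \<Delta> * eps_u S)"
proof -
  interpret fl_setting S by fact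
  define E where "E = exp (2 * xi S) - 1"
  define T where "T = (\<Sum>k=1..num_clients S. TV (P_O S k) (P_S S k))"
  let ?K = "real (num_clients S)"
  \<comment> \<open>\<open>xi_nonneg\<close> is relative to a client; client 1 always
    exists.\<close>
  have E: "0 \<le> E" using xi_nonneg[of 1] clients by (simp add: E_def)
  have T: "0 \<le> T" unfolding T_def by (intro sum_nonneg TV_client_nonneg)
  have K: "0 < ?K" using clients by simp
  have C1: "C1 S \<le> eps_p S + 3 / 8 * E / ?K * T"
    using C1_le by (simp add: E_def T_def)
  show ?thesis
  proof (intro conjI allI impI)
    have sum_eq: "(\<Sum>k=1..num_clients S. 1 / 2 * E * TV (P_O S k) (P_S S k)) = 1 / 2 * E * T"
      by (simp only: T_def sum_distrib_left)
    have "3 / 8 * E / ?K * T \<le> 1 / 2 * E / ?K * T"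
      using E T K by (intro mult_right_mono divide_right_mono) auto
    also have "\<dots> = 1 / ?K * (\<Sum>k=1..num_clients S. 1 / 2 * E * TV (P_O S k) (P_S S k))"
      unfolding sum_eq by simp
    finally show "C1 S \<le> eps_p S + 1 / ?K *
        (\<Sum>k=1..num_clients S. 1 / 2 * (exp (2 * xi S) - 1) * TV (P_O S k) (P_S S k))"
      using C1 by (simp add: E_def)
  next
    fix \<Delta>
    assume K3: "3 \<le> num_clients S" and conv: "Wa_O S \<subseteq> W_opt S"
      and TV: "0 < TV (Pa_O S) (Pa_S S)" and \<Delta>: "is_Delta S \<Delta>" "0 < \<Delta>"
    let ?V = "TV (Pa_O S) (Pa_S S)"
    \<comment> \<open>As \<open>?V \<le> 1\<close>, both \<open>?V / 2 \<le> 1 / 2\<close> and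
      \<open>1 / 2 \<le> 1 - ?V / 2\<close> hold.\<close>
    have "\<Delta> * (?V / 2) \<le> \<Delta> * (1 - ?V / 2)"
      using TV_agg_le_1 \<Delta>(2) by (intro mult_left_mono) auto
    also have "\<dots> \<le> eps_u S" by (rule eps_u_ge[OF conv \<Delta>(1)])
    finally have u: "\<Delta> * ?V / 2 \<le> eps_u S" by simp
    \<comment> \<open>Three clients bring the constant down to \<open>1 / 8\<close>, exactly the
      product of the \<open>1 / 4\<close> in \<open>C2\<close> and the \<open>1 / 2\<close> in the
      lower bound for \<open>eps_u S\<close>.\<close>
    have "3 / 8 * E / ?K * T \<le> 3 / 8 * E / 3 * T"
      using E T K3 by (intro mult_right_mono divide_left_mono) auto
    also have "\<dots> = T / ?V / (4 * \<Delta>) * E * (\<Delta> * ?V / 2)"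
      using TV \<Delta>(2) by simp
    also have "\<dots> \<le> T / ?V / (4 * \<Delta>) * E * eps_u S"
      using u E T TV \<Delta>(2) by (intro mult_left_mono) auto
    also have "\<dots> = C2 S \<Delta> * eps_u S"
      by (simp add: C2_def gamma_def T_def E_def)
    finally show "C1 S \<le> eps_p S + C2 S \<Delta> * eps_u S" using C1 by simp
  qed
qed

end
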